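(* Let $\mathbf{X}\in\mathbb{D}_n$ and $\mathbf{w}\in\mathbb{R}^n$ be such that every Laguerre cell $\mathrm{Lag}_i(\mathbf{X},\mathbf{w})$, $i\in\{1,\ldots,n\}$, has positive volume. For $i\in\{1,\ldots,n\}$ define $v_i=\mathrm{vol}(\mathrm{Lag}_i(\mathbf{X},\mathbf{w}))$ and $b_i=\sigma(\mathrm{Lag}_i(\mathbf{X},\mathbf{w}))$ to be the volume and centroid of the $i$-th Laguerre cell, and let $\mathbf{v}=(v_1,\ldots,v_n)$, $\mathbf{B}=(b_1,\ldots,b_n)$. Then the concave function $H(\,\cdot\,;(\mathbf{v},\mathbf{B}))$ achieves its maximum over $\mathbb{R}^{nd}$ in $\mathbb{D}_n$. Moreover, if $\mathbf{Y}\in\mathbb{D}_n$ is any maximiser of $H(\,\cdot\,;(\mathbf{v},\mathbf{B}))$ over $\mathbb{R}^{nd}$, then $$L_i(\mathbf{Y};\mathbf{v})=L_i(\mathbf{X};\mathbf{v})\quad\forall\, i\in\{1,\ldots,n\}.$$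
   Context: Let $d\ge 2$ and let $\Omega\subset\mathbb{R}^d$ be a non-empty, convex, bounded set equal to the closure of its interior. For a Lebesgue-measurable $A\subseteq\mathbb{R}^d$, $\mathrm{vol}(A)$ is its $d$-dimensional Lebesgue measure and, if $\mathrm{vol}(A)\neq 0$, $\sigma(A)=\frac{1}{\mathrm{vol}(A)}\int_A x\,dx$ is its centroid. $\mathbb{D}_n=\{\mathbf{X}=(x_1,\ldots,x_n)\in(\mathbb{R}^d)^n : x_i\ne x_j \text{ for all } i\neq j\}$ is the set of distinct seeds; $(\mathbb{R}^d)^n$ is identified with $\mathbb{R}^{nd}$. For $\mathbf{X}\in\mathbb{D}_n$ and $\mathbf{w}=(w_1,\ldots,w_n)\in\mathbb{R}^n$, the $i$-th Laguerre cell is $$\mathrm{Lag}_i(\mathbf{X},\mathbf{w})=\{x\in\Omega : |x-x_i|^2-w_i\le |x-x_j|^2-w_j\ \forall j\in\{1,\ldots,n\}\}.$$ $\mathbb{V}_n=\{\mathbf{v}\in(0,\infty)^n : \sum_{i=1}^n v_i=\mathrm{vol}(\Omega)\}$. For $\mathbf{X}\in\mathbb{D}_n$ and $\mathbf{v}\in\mathbb{V}_n$, it is known that there exists $\mathbf{w}\in\mathbb{R}^n$, unique up to adding the same constant to all components (and made unique by requiring $w_n=0$), such that $\mathrm{vol}(\mathrm{Lag}_i(\mathbf{X},\mathbf{w}))=v_i$ for all $i$; denote it $\mathbf{w}^*(\mathbf{X};\mathbf{v})$. Set $L_i(\mathbf{X};\mathbf{v})=\mathrm{Lag}_i(\mathbf{X},\mathbf{w}^*(\mathbf{X};\mathbf{v}))$.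 For $\mathbf{X}\in\mathbb{R}^{nd}$ (seeds not necessarily distinct) and $\mathbf{v}\in\mathbb{V}_n$, let $\nu(\mathbf{X},\mathbf{v})=\sum_{i=1}^n v_i\delta_{x_i}$, let $\mathcal{L}^d_\Omega$ be Lebesgue measure restricted to $\Omega$, and let $W_2$ be the quadratic Wasserstein distance: $$W_2^2(\mathcal{L}^d_\Omega,\nu(\mathbf{X},\mathbf{v}))=\inf_T\int_\Omega|x-T(x)|^2\,dx,$$ the infimum being over measurable maps $T:\Omega\to\{x_1,\ldots,x_n\}$ pushing $\mathcal{L}^d_\Omega$ forward to $\nu(\mathbf{X},\mathbf{v})$. For $\mathbf{v}\in\mathbb{V}_n$ and $\mathbf{B}=(b_1,\ldots,b_n)\in\Omega^n$ define $H(\,\cdot\,;(\mathbf{v},\mathbf{B})):\mathbb{R}^{nd}\to\mathbb{R}$ by $$H(\mathbf{X};(\mathbf{v},\mathbf{B}))=\tfrac12 W_2^2(\mathcal{L}^d_\Omega,\nu(\mathbf{X},\mathbf{v}))-\tfrac12\sum_{i=1}^n v_i|x_i|^2+\sum_{i=1}^n v_i\,x_i\cdot b_i-\tfrac12\int_\Omega|x|^2\,dx.$$ *)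

theory Defs
  imports "HOL-Analysis.Analysis"
begin

text \<open>
  Seeds live in \<open>real ^ 'd\<close>. An \<open>n\<close>-tuple is a vector over a finite linearly ordered index type
  \<open>'n\<close>, which plays the role of \<open>{1, ..., n}\<close>; its greatest element plays the role of the index
  \<open>n\<close>. The order is only used to normalise the weight vector. The ambient set \<open>\<Omega>\<close> is an explicit
  argument throughout.
\<close>

definition vol :: "(real ^ 'd) set \<Rightarrow> real" where
  "vol A = measure lebesgue A"

definition centroid :: "(real ^ 'd) set \<Rightarrow> real ^ 'd" where
  "centroid A = (1 / vol A) *\<^sub>R (\<integral>x. x \<partial>(lebesgue_on A))"

definition distinct_seeds :: "((real ^ 'd) ^ 'n) set" where
  "distinct_seeds = {X. \<forall>i j. i \<noteq> j \<longrightarrow> X $ i \<noteq> X $ j}"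

definition Lag :: "(real ^ 'd) set \<Rightarrow> (real ^ 'd) ^ 'n \<Rightarrow> real ^ 'n \<Rightarrow> 'n \<Rightarrow> (real ^ 'd) set" where
  "Lag \<Omega> X w i =
     {x \<in> \<Omega>. \<forall>j. (norm (x - X $ i))\<^sup>2 - w $ i \<le> (norm (x - X $ j))\<^sup>2 - w $ j}"

text \<open>
  For a convex body \<open>\<Omega>\<close>, the description determines the weights when the seeds are distinct and the
  components of \<open>v\<close> are positive and sum to \<open>vol \<Omega>\<close>; otherwise the value is irrelevant.
\<close>

definition opt_weights ::
    "(real ^ 'd) set \<Rightarrow> (real ^ 'd) ^ ('n::{finite,linorder}) \<Rightarrow> real ^ ('n::{finite,linorder})
     \<Rightarrow> real ^ ('n::{finite,linorder})" where
  "opt_weights \<Omega> X v =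
     (THE w. w $ Max UNIV = 0 \<and> (\<forall>i. vol (Lag \<Omega> X w i) = v $ i))"

definition Lcell ::
    "(real ^ 'd) set \<Rightarrow> (real ^ 'd) ^ ('n::{finite,linorder}) \<Rightarrow> real ^ ('n::{finite,linorder})
     \<Rightarrow> 'n \<Rightarrow> (real ^ 'd) set" where
  "Lcell \<Omega> X v i = Lag \<Omega> X (opt_weights \<Omega> X v) i"

text \<open>The discrete measure with mass \<open>v $ i\<close> at \<open>X $ i\<close>; masses of coinciding seeds add up.\<close>

definition discrete_target :: "(real ^ 'd) ^ 'n \<Rightarrow> real ^ 'n \<Rightarrow> (real ^ 'd) measure" where
  "discrete_target X v =
     measure_of UNIV (sets borel) (\<lambda>A. \<Sum>i\<in>UNIV. ennreal (v $ i) * indicator A (X $ i))"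

lemma sets_discrete_target [simp]: "sets (discrete_target X v) = sets borel"
  unfolding discrete_target_def using sets.sets_measure_of_eq[of borel] by simp

lemma emeasure_discrete_target:
  assumes "A \<in> sets borel"
  shows "emeasure (discrete_target X v) A = (\<Sum>i\<in>UNIV. ennreal (v $ i) * indicator A (X $ i))"
proof (rule emeasure_measure_of[OF discrete_target_def])
  show "countably_additive (sets (discrete_target X v))
          (\<lambda>A. \<Sum>i\<in>UNIV. ennreal (v $ i) * indicator A (X $ i))"
  proof (rule countably_additiveI)
    fix F :: "nat \<Rightarrow> (real ^ 'a) set"
    assume "disjoint_family F"
    then have "(\<Sum>k. indicator (F k) (X $ i)) = (indicator (\<Union>k. F k) (X $ i) :: ennreal)" for i
      by (rule suminf_indicator)
    then show "(\<Sum>k. \<Sum>i\<in>UNIV. ennreal (v $ i) * indicator (F k) (X $ i))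
        = (\<Sum>i\<in>UNIV. ennreal (v $ i) * indicator (\<Union>k. F k) (X $ i))"
      by (subst suminf_sum) (simp_all add: summableI)
  qed
  show "positive (sets (discrete_target X v)) (\<lambda>A. \<Sum>i\<in>UNIV. ennreal (v $ i) * indicator A (X $ i))"
    by (simp add: positive_def)
qed (simp_all add: assms)

definition transport_maps ::
    "(real ^ 'd) set \<Rightarrow> (real ^ 'd) ^ 'n \<Rightarrow> real ^ 'n \<Rightarrow> (real ^ 'd \<Rightarrow> real ^ 'd) set" where
  "transport_maps \<Omega> X v =
     {T. T \<in> borel_measurable (lebesgue_on \<Omega>) \<and> T ` \<Omega> \<subseteq> range (\<lambda>i. X $ i) \<and>
         distr (lebesgue_on \<Omega>) borel T = discrete_target X v}"

text \<open>The squared quadratic Wasserstein distance between Lebesgue measure on \<open>\<Omega>\<close> and the target.\<close>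

definition W2_squared :: "(real ^ 'd) set \<Rightarrow> (real ^ 'd) ^ 'n \<Rightarrow> real ^ 'n \<Rightarrow> real" where
  "W2_squared \<Omega> X v =
     (INF T\<in>transport_maps \<Omega> X v. \<integral>x. (norm (x - T x))\<^sup>2 \<partial>(lebesgue_on \<Omega>))"

definition H ::
    "(real ^ 'd) set \<Rightarrow> real ^ 'n \<Rightarrow> (real ^ 'd) ^ 'n \<Rightarrow> (real ^ 'd) ^ 'n \<Rightarrow> real" where
  "H \<Omega> v B X =
     1 / 2 * W2_squared \<Omega> X v - 1 / 2 * (\<Sum>i\<in>UNIV. v $ i * (norm (X $ i))\<^sup>2)
     + (\<Sum>i\<in>UNIV. v $ i * (X $ i \<bullet> B $ i)) - 1 / 2 * (\<integral>x. (norm x)\<^sup>2 \<partial>(lebesgue_on \<Omega>))"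

end

theory Submission
  imports Defs
begin

text \<open>
  The maps with value \<open>Z $ i\<close> on \<open>A\<^sub>i\<close>, for partitions \<open>A\<close> of \<open>\<Omega>\<close> with cell volumes \<open>v\<close>, are all
  the transport maps for \<open>Z\<close>, even when seeds coincide, because a level set can be cut into pieces of
  prescribed volume. Expanding the square, \<open>H\<close> becomes an infimum over a set of partitions that does
  not depend on \<open>Z\<close>:
  \<open>H(Z) = inf\<^sub>A (\<Sum>i. \<integral>\<^bsub>Lag\<^sub>i(X,w)\<^esub> x \<bullet> z\<^sub>i - \<Sum>i. \<integral>\<^bsub>A\<^sub>i\<^esub> x \<bullet> z\<^sub>i)\<close>.
  Each term is linear in \<open>Z\<close>, so \<open>H\<close> is concave; the choice \<open>A = Lag(X,w)\<close> gives \<open>H \<le> 0\<close>; and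
  \<open>H(X) = 0\<close> since Laguerre partitions are optimal for their own seeds. If \<open>Y\<close> is another maximiser
  with distinct seeds, then \<open>H(Y) = 0\<close> says that \<open>Lag(X,w)\<close> is an optimal partition for \<open>Y\<close>. Optimal
  partitions agree almost everywhere with the Laguerre partition of the same volumes, and convex closed
  cells which agree almost everywhere are equal.
\<close>

section \<open>Partitions with prescribed volumes\<close>

text \<open>Cut A by balls about the origin: the volume of the part inside radius r rises
  continuously from 0 to the volume of A, so the intermediate value theorem yields the
  radius.\<close>

lemma exists_subset_of_measure:
  fixes A :: "'a::euclidean_space set"
  assumes A: "A \<in> lmeasurable" "bounded A" and c: "0 \<le> c" "c \<le> measure lebesgue A"
  shows "\<exists>B\<subseteq>A. B \<in> lmeasurable \<and> measure lebesgue B = c"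
proof -
  obtain R where R: "R > 0" "A \<subseteq> cball 0 R"
    using bounded_subset_ballD[OF A(2), of 0] ball_subset_cball by blast
  define f where "f r = measure lebesgue (A \<inter> cball 0 r)" for r
  have meas: "A \<inter> cball 0 r \<in> lmeasurable" for r
    using A(1) by (intro fmeasurable_Int_fmeasurable) auto
  have mono: "f r \<le> f s" if "r \<le> s" for r s
    unfolding f_def using that meas by (intro measure_mono_fmeasurable) (auto simp: fmeasurableD)
  \<comment> \<open>The shell of A between two radii lies in the full shell, so f inherits
    continuity from the volume of balls, a constant times a power of the radius.\<close>
  have diff: "f s - f r \<le> measure lebesgue (cball (0::'a) s) - measure lebesgue (cball (0::'a) r)" if "r \<le> s" for r s
  proof -
    have "f s - f r = measure lebesgue ((A \<inter> cball 0 s) - (A \<inter> cball 0 r))"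
      unfolding f_def using that meas
      by (subst measurable_measure_Diff) (auto simp: fmeasurableD)
    also have "\<dots> \<le> measure lebesgue (cball (0::'a) s - cball 0 r)"
      using meas by (intro measure_mono_fmeasurable) (auto simp: fmeasurableD intro!: sets.Diff fmeasurable_Diff)
    also have "\<dots> = measure lebesgue (cball (0::'a) s) - measure lebesgue (cball (0::'a) r)"
      using that by (subst measurable_measure_Diff) auto
    finally show ?thesis .
  qed
  have "continuous_on {0..R} (\<lambda>r. measure lebesgue (cball (0::'a) r))"
    by (rule continuous_on_eq[of _ "\<lambda>r. unit_ball_vol (real DIM('a)) * r ^ DIM('a)"])
      (auto intro!: continuous_intros simp: content_cball)
  then have "continuous_on {0..R} f"
    unfolding continuous_on_iff
  proof (intro ballI allI impI, goal_cases)
    case (1 x e)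
    then obtain d where d: "d > 0" "\<And>x'. x' \<in> {0..R} \<Longrightarrow> dist x' x < d \<Longrightarrow>
        dist (measure lebesgue (cball (0::'a) x')) (measure lebesgue (cball (0::'a) x)) < e"
      by metis
    have "dist (f x') (f x) < e" if "x' \<in> {0..R}" "dist x' x < d" for x'
      using d(2)[OF that] mono[of x x'] mono[of x' x] diff[of x x'] diff[of x' x]
      unfolding dist_real_def by (cases "x \<le> x'") auto
    with d(1) show ?case by blast
  qed
  moreover have "f 0 = 0"
    unfolding f_def by (rule negligible_imp_measure0, rule negligible_subset[of "{0}"]) auto
  moreover have "f R = measure lebesgue A"
    unfolding f_def using R by (simp add: Int_absorb2)
  ultimately obtain r where "f r = c"
    using IVT'[of f 0 c R] c R by auto
  then show ?thesis
    unfolding f_def using meas by (intro exI[of _ "A \<inter> cball 0 r"]) auto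
qed

text \<open>Pieces are peeled off one at a time. This will divide a level set of a transport map
  among the indices whose seeds coincide.\<close>

lemma exists_partition_of_measure:
  fixes A :: "'a::euclidean_space set"
  assumes "finite I" "I \<noteq> {}" "A \<in> lmeasurable" "bounded A"
    and "\<And>i. i \<in> I \<Longrightarrow> 0 \<le> v i" "measure lebesgue A = sum v I"
  shows "\<exists>s. (\<forall>x\<in>A. s x \<in> I) \<and>
    (\<forall>i\<in>I. {x \<in> A. s x = i} \<in> lmeasurable \<and> measure lebesgue {x \<in> A. s x = i} = v i)"
  using assms
proof (induction I arbitrary: A rule: finite_ne_induct)
  case (singleton i)
  then show ?case by (intro exI[of _ "\<lambda>_. i"]) auto
next
  case (insert i F)
  have nn: "0 \<le> v i" "0 \<le> sum v F" using insert.prems by (auto intro: sum_nonneg)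
  obtain B where B: "B \<subseteq> A" "B \<in> lmeasurable" "measure lebesgue B = v i"
    using exists_subset_of_measure[OF insert.prems(1,2), of "v i"] insert nn by auto
  have "A - B \<in> lmeasurable" using B insert.prems by (intro fmeasurable_Diff) (auto simp: fmeasurableD)
  moreover have "bounded (A - B)" using insert.prems by (auto intro: bounded_subset)
  moreover have "measure lebesgue (A - B) = sum v F"
    using insert B by (subst measurable_measure_Diff) (auto simp: fmeasurableD)
  ultimately obtain s where s: "\<forall>x\<in>A - B. s x \<in> F"
      "\<forall>j\<in>F. {x \<in> A - B. s x = j} \<in> lmeasurable \<and> measure lebesgue {x \<in> A - B. s x = j} = v j"
    using insert.IH[of "A - B"] insert.prems by auto
  define t where "t x = (if x \<in> B then i else s x)" for x
  have "{x \<in> A. t x = i} = B"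
    using B s(1) insert.hyps by (auto simp: t_def split: if_splits)
  moreover have "{x \<in> A. t x = j} = {x \<in> A - B. s x = j}" if "j \<in> F" for j
    using that insert.hyps by (auto simp: t_def)
  moreover have "\<forall>x\<in>A. t x \<in> insert i F" using s(1) by (auto simp: t_def)
  ultimately show ?case using B s(2) by (intro exI[of _ t]) auto
qed

section \<open>Transport maps as partitions\<close>

text \<open>A partition is encoded by the function sending a point to the index of its cell.\<close>

definition assignments :: "(real ^ 'd) set \<Rightarrow> real ^ 'n \<Rightarrow> (real ^ 'd \<Rightarrow> 'n) set" where
  "assignments \<Omega> v = {s. \<forall>i. {x \<in> \<Omega>. s x = i} \<in> sets lebesgue \<and> vol {x \<in> \<Omega>. s x = i} = v $ i}"

lemma assignment_measurable:
  fixes s :: "real ^ 'd \<Rightarrow> 'n::finite"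
  assumes "s \<in> assignments \<Omega> v" "\<Omega> \<in> sets lebesgue"
  shows "s \<in> lebesgue_on \<Omega> \<rightarrow>\<^sub>M count_space UNIV"
proof -
  have "s -` {i} \<inter> \<Omega> = {x \<in> \<Omega>. s x = i}" for i by auto
  then show ?thesis
    using assms unfolding assignments_def
    by (auto simp: measurable_count_space_eq2 sets_restrict_space_iff)
qed

lemma integrable_continuous_on_compact:
  fixes f :: "real ^ 'd \<Rightarrow> 'b::{banach,second_countable_topology}"
  assumes "compact \<Omega>" "continuous_on \<Omega> f"
  shows "integrable (lebesgue_on \<Omega>) f"
proof -
  interpret finite_measure "lebesgue_on \<Omega>"
    using assms by (intro finite_measure_lebesgue_on lmeasurable_compact)
  obtain C where "\<And>x. x \<in> \<Omega> \<Longrightarrow> norm (f x) \<le> C"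
    using compact_imp_bounded[OF compact_continuous_image[OF assms(2,1)]] unfolding bounded_iff by auto
  then show ?thesis
    using assms
    by (intro integrable_const_bound[of _ C] continuous_imp_measurable_on_sets_lebesgue AE_I2)
      (auto intro: fmeasurableD lmeasurable_compact)
qed

text \<open>On \<Omega> the integrand is a finite sum of the functions \<open>f i\<close>, each
  multiplied by the indicator of its cell.\<close>

lemma assignment_integrable:
  fixes s :: "real ^ 'd \<Rightarrow> 'n::finite" and f :: "'n \<Rightarrow> real ^ 'd \<Rightarrow> 'b::{banach,second_countable_topology}"
  assumes "s \<in> assignments \<Omega> v" "compact \<Omega>" "\<And>i. continuous_on \<Omega> (f i)"
  shows "integrable (lebesgue_on \<Omega>) (\<lambda>x. f (s x) x)"
    and "(\<integral>x. f (s x) x \<partial>lebesgue_on \<Omega>) =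
      (\<Sum>i\<in>UNIV. \<integral>x. f i x \<partial>lebesgue_on {x \<in> \<Omega>. s x = i})"
proof -
  have \<Omega>: "\<Omega> \<in> sets lebesgue" using assms(2) by (auto intro: fmeasurableD lmeasurable_compact)
  have S: "{x \<in> \<Omega>. s x = i} \<in> sets lebesgue" for i using assms(1) by (auto simp: assignments_def)
  then have S': "{x \<in> \<Omega>. s x = i} \<in> sets (lebesgue_on \<Omega>)" for i
    by (auto simp: sets_restrict_space_iff \<Omega>)
  have eq: "f (s x) x = (\<Sum>i\<in>UNIV. indicat_real {x \<in> \<Omega>. s x = i} x *\<^sub>R f i x)" if "x \<in> \<Omega>" for x
  proof -
    have "(\<Sum>i\<in>UNIV. indicat_real {x \<in> \<Omega>. s x = i} x *\<^sub>R f i x) =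
       (\<Sum>i\<in>UNIV. if s x = i then f i x else 0)"
      using that by (intro sum.cong) auto
    then show ?thesis by simp
  qed
  have int: "integrable (lebesgue_on \<Omega>) (\<lambda>x. indicat_real {x \<in> \<Omega>. s x = i} x *\<^sub>R f i x)" for i
    by (intro integrable_mult_indicator S' integrable_continuous_on_compact assms)
  show "integrable (lebesgue_on \<Omega>) (\<lambda>x. f (s x) x)"
    by (subst Bochner_Integration.integrable_cong[OF refl eq], simp, intro Bochner_Integration.integrable_sum int)
  have "(\<integral>x. f (s x) x \<partial>lebesgue_on \<Omega>) =
      (\<integral>x. (\<Sum>i\<in>UNIV. indicat_real {x \<in> \<Omega>. s x = i} x *\<^sub>R f i x) \<partial>lebesgue_on \<Omega>)"
    by (intro Bochner_Integration.integral_cong refl eq) auto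
  also have "\<dots> = (\<Sum>i\<in>UNIV. \<integral>x. indicat_real {x \<in> \<Omega>. s x = i} x *\<^sub>R f i x \<partial>lebesgue_on \<Omega>)"
    by (intro Bochner_Integration.integral_sum int)
  also have "\<dots> = (\<Sum>i\<in>UNIV. \<integral>x. f i x \<partial>lebesgue_on {x \<in> \<Omega>. s x = i})"
    using S \<Omega> by (intro sum.cong refl, simp add: integral_restrict_space)
      (auto intro!: Bochner_Integration.integral_cong simp: indicator_def)
  finally show "(\<integral>x. f (s x) x \<partial>lebesgue_on \<Omega>) =
      (\<Sum>i\<in>UNIV. \<integral>x. f i x \<partial>lebesgue_on {x \<in> \<Omega>. s x = i})" .
qed

text \<open>Such integrals depend on the volumes alone, so they cancel whenever two assignments with
  the same v are compared.\<close>

lemma assignment_integral_const: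
  fixes s :: "real ^ 'd \<Rightarrow> 'n::finite" and c :: "'n \<Rightarrow> real"
  assumes "s \<in> assignments \<Omega> v" "compact \<Omega>"
  shows "(\<integral>x. c (s x) \<partial>lebesgue_on \<Omega>) = (\<Sum>i\<in>UNIV. v $ i * c i)"
proof -
  have "measure (lebesgue_on {x \<in> \<Omega>. s x = i}) {x \<in> \<Omega>. s x = i} = v $ i" for i
    using assms(1) by (subst measure_restrict_space) (auto simp: assignments_def vol_def)
  then show ?thesis
    using assignment_integrable(2)[OF assms, of "\<lambda>i _. c i"] by simp
qed

text \<open>From left to right, the level set of T over z has the total mass of the seeds located at
  z, so it can be cut into pieces of the individual masses. From right to left, the image mass of a
  set is the integral of its indicator along s.\<close>

lemma mem_transport_maps_iff:
  fixes Z :: "(real ^ 'd) ^ 'n::finite"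
  assumes \<Omega>: "compact \<Omega>" and v: "\<And>i. 0 \<le> v $ i"
  shows "T \<in> transport_maps \<Omega> Z v \<longleftrightarrow>
    T \<in> borel_measurable (lebesgue_on \<Omega>) \<and> (\<exists>s\<in>assignments \<Omega> v. \<forall>x\<in>\<Omega>. T x = Z $ s x)"
proof -
  have \<Omega>_sets: "\<Omega> \<in> sets lebesgue" using \<Omega> by (auto intro: fmeasurableD lmeasurable_compact)
  have \<Omega>_lm: "\<Omega> \<in> lmeasurable" using \<Omega> by (rule lmeasurable_compact)
  show ?thesis
  proof (intro iffI conjI; (elim conjE)?)
    assume T: "T \<in> transport_maps \<Omega> Z v"
    then show meas: "T \<in> borel_measurable (lebesgue_on \<Omega>)" by (simp add: transport_maps_def)
    define A where "A z = {x \<in> \<Omega>. T x = z}" for z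
    have A: "A z \<in> lmeasurable" "measure lebesgue (A z) = (\<Sum>i | Z $ i = z. v $ i)" for z
    proof -
      have *: "A z = T -` {z} \<inter> space (lebesgue_on \<Omega>)" by (auto simp: A_def)
      have s: "A z \<in> sets (lebesgue_on \<Omega>)" unfolding * using meas by (rule measurable_sets) simp
      then have s': "A z \<in> sets lebesgue" using \<Omega>_sets by (simp add: sets_restrict_space_iff)
      show lm: "A z \<in> lmeasurable"
        by (rule fmeasurableI2[OF \<Omega>_lm _ s']) (auto simp: A_def)
      have "emeasure lebesgue (A z) = emeasure (lebesgue_on \<Omega>) (A z)"
        using \<Omega>_sets by (subst emeasure_restrict_space) (auto simp: A_def)
      also have "\<dots> = emeasure (distr (lebesgue_on \<Omega>) borel T) {z}"
        unfolding * using meas by (subst emeasure_distr) auto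
      also have "\<dots> = (\<Sum>i\<in>UNIV. ennreal (v $ i) * indicator {z} (Z $ i))"
        using T by (simp add: transport_maps_def emeasure_discrete_target)
      also have "\<dots> = (\<Sum>i\<in>UNIV. ennreal (if Z $ i = z then v $ i else 0))"
        by (intro sum.cong) auto
      also have "\<dots> = ennreal (\<Sum>i\<in>UNIV. if Z $ i = z then v $ i else 0)"
        using v by (intro sum_ennreal) auto
      also have "(\<Sum>i\<in>UNIV. if Z $ i = z then v $ i else 0) = (\<Sum>i | Z $ i = z. v $ i)"
        by (simp add: sum.If_cases)
      finally show "measure lebesgue (A z) = (\<Sum>i | Z $ i = z. v $ i)"
        using v by (simp add: measure_def sum_nonneg)
    qed
    \<comment> \<open>For each seed position z, the map \<open>S z\<close> distributes the level set
      over z among the indices with seed z. The assignment sought is then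
      \<open>S (T x) x\<close>.\<close>
    have "\<forall>z\<in>range (($) Z). \<exists>s. (\<forall>x\<in>A z. s x \<in> {i. Z $ i = z}) \<and>
        (\<forall>i\<in>{i. Z $ i = z}. {x \<in> A z. s x = i} \<in> lmeasurable \<and> measure lebesgue {x \<in> A z. s x = i} = v $ i)"
    proof
      fix z assume "z \<in> range (($) Z)"
      then have ne: "{i. Z $ i = z} \<noteq> {}" by auto
      have "bounded (A z)" using compact_imp_bounded[OF \<Omega>] by (rule bounded_subset) (auto simp: A_def)
      then show "\<exists>s. (\<forall>x\<in>A z. s x \<in> {i. Z $ i = z}) \<and>
          (\<forall>i\<in>{i. Z $ i = z}. {x \<in> A z. s x = i} \<in> lmeasurable \<and> measure lebesgue {x \<in> A z. s x = i} = v $ i)"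
        using A v ne by (intro exists_partition_of_measure) auto
    qed
    from bchoice[OF this] obtain S where S:
      "\<And>z x. z \<in> range (($) Z) \<Longrightarrow> x \<in> A z \<Longrightarrow> Z $ S z x = z"
      "\<And>i. {x \<in> A (Z $ i). S (Z $ i) x = i} \<in> lmeasurable"
      "\<And>i. measure lebesgue {x \<in> A (Z $ i). S (Z $ i) x = i} = v $ i"
      by fastforce
    have Ts: "T x = Z $ S (T x) x" if "x \<in> \<Omega>" for x
      using that T by (subst S(1)) (auto simp: A_def transport_maps_def)
    have "{x \<in> \<Omega>. S (T x) x = i} = {x \<in> A (Z $ i). S (Z $ i) x = i}" for i
      using Ts by (auto simp: A_def)
    then have "(\<lambda>x. S (T x) x) \<in> assignments \<Omega> v"
      using S by (auto simp: assignments_def vol_def fmeasurableD)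
    then show "\<exists>s\<in>assignments \<Omega> v. \<forall>x\<in>\<Omega>. T x = Z $ s x"
      using Ts by (intro bexI[of _ "\<lambda>x. S (T x) x"]) auto
  next
    assume meas: "T \<in> borel_measurable (lebesgue_on \<Omega>)"
      and "\<exists>s\<in>assignments \<Omega> v. \<forall>x\<in>\<Omega>. T x = Z $ s x"
    then obtain s where s: "s \<in> assignments \<Omega> v" "\<And>x. x \<in> \<Omega> \<Longrightarrow> T x = Z $ s x" by auto
    have "distr (lebesgue_on \<Omega>) borel T = discrete_target Z v"
    proof (rule measure_eqI)
      fix B assume "B \<in> sets (distr (lebesgue_on \<Omega>) borel T)"
      then have B: "B \<in> sets borel" by simp
      interpret finite_measure "lebesgue_on \<Omega>"
        using \<Omega>_lm by (rule finite_measure_lebesgue_on)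
      have TB: "T -` B \<inter> \<Omega> \<in> sets (lebesgue_on \<Omega>)"
        using measurable_sets[OF meas B] by simp
      have "measure (lebesgue_on \<Omega>) (T -` B \<inter> \<Omega>) = (\<integral>x. indicat_real (T -` B \<inter> \<Omega>) x \<partial>lebesgue_on \<Omega>)"
        using TB by simp
      also have "\<dots> = (\<integral>x. indicat_real B (Z $ s x) \<partial>lebesgue_on \<Omega>)"
        using s(2) by (intro Bochner_Integration.integral_cong) (auto simp: indicator_def)
      also have "\<dots> = (\<Sum>i\<in>UNIV. v $ i * indicat_real B (Z $ i))"
        by (rule assignment_integral_const[OF s(1) \<Omega>])
      finally have "emeasure (lebesgue_on \<Omega>) (T -` B \<inter> \<Omega>) =
          ennreal (\<Sum>i\<in>UNIV. v $ i * indicat_real B (Z $ i))"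
        by (simp add: emeasure_eq_measure)
      also have "\<dots> = (\<Sum>i\<in>UNIV. ennreal (v $ i * indicat_real B (Z $ i)))"
        using v by (intro sum_ennreal[symmetric]) auto
      also have "\<dots> = (\<Sum>i\<in>UNIV. ennreal (v $ i) * indicator B (Z $ i))"
        using v by (intro sum.cong) (auto simp: indicator_def)
      finally show "emeasure (distr (lebesgue_on \<Omega>) borel T) B = emeasure (discrete_target Z v) B"
        using meas B by (simp add: emeasure_distr emeasure_discrete_target)
    qed simp
    then show "T \<in> transport_maps \<Omega> Z v"
      using meas s(2) by (auto simp: transport_maps_def)
  qed
qed

lemma W2_squared_eq:
  fixes Z :: "(real ^ 'd) ^ 'n::finite"
  assumes \<Omega>: "compact \<Omega>" and v: "\<And>i. 0 \<le> v $ i"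
  shows "W2_squared \<Omega> Z v = (INF s\<in>assignments \<Omega> v. \<integral>x. (norm (x - Z $ s x))\<^sup>2 \<partial>lebesgue_on \<Omega>)"
proof -
  have \<Omega>_sets: "\<Omega> \<in> sets lebesgue" using \<Omega> by (auto intro: fmeasurableD lmeasurable_compact)
  have "(\<lambda>T. \<integral>x. (norm (x - T x))\<^sup>2 \<partial>lebesgue_on \<Omega>) ` transport_maps \<Omega> Z v =
    (\<lambda>s. \<integral>x. (norm (x - Z $ s x))\<^sup>2 \<partial>lebesgue_on \<Omega>) ` assignments \<Omega> v" (is "?f ` _ = ?g ` _")
  proof (intro subset_antisym subsetI)
    fix r assume "r \<in> ?f ` transport_maps \<Omega> Z v"
    then obtain T where T: "T \<in> transport_maps \<Omega> Z v" "r = ?f T" by auto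
    then obtain s where s: "s \<in> assignments \<Omega> v" "\<forall>x\<in>\<Omega>. T x = Z $ s x"
      using mem_transport_maps_iff[OF \<Omega> v] by metis
    have "?f T = ?g s" using s by (intro Bochner_Integration.integral_cong) auto
    then show "r \<in> ?g ` assignments \<Omega> v" using s T by auto
  next
    fix r assume "r \<in> ?g ` assignments \<Omega> v"
    then obtain s where s: "s \<in> assignments \<Omega> v" "r = ?g s" by auto
    have "(\<lambda>x. Z $ s x) \<in> borel_measurable (lebesgue_on \<Omega>)"
      using assignment_measurable[OF s(1) \<Omega>_sets] by (rule measurable_compose) simp
    then have "(\<lambda>x. Z $ s x) \<in> transport_maps \<Omega> Z v"
      using mem_transport_maps_iff[OF \<Omega> v] s(1) by fastforce
    then show "r \<in> ?f ` transport_maps \<Omega> Z v" using s(2) by auto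
  qed
  then show ?thesis by (simp add: W2_squared_def)
qed

section \<open>Optimality of Laguerre partitions\<close>

text \<open>The quadratic term in x cancels in the comparison of two seeds, so each constraint is
  affine. Compactness and convexity of the cells follow from those of \<Omega>.\<close>

lemma Lag_eq_halfspaces:
  "Lag \<Omega> Y w i =
    \<Omega> \<inter> (\<Inter>j. {x. (2 *\<^sub>R (Y $ j - Y $ i)) \<bullet> x \<le> (norm (Y $ j))\<^sup>2 - w $ j - (norm (Y $ i))\<^sup>2 + w $ i})"
  by (auto simp: Lag_def power2_norm_eq_inner algebra_simps inner_commute)

lemma Lag_subset: "Lag \<Omega> Y w i \<subseteq> \<Omega>"
  by (auto simp: Lag_def)

lemma compact_Lag: "compact \<Omega> \<Longrightarrow> compact (Lag \<Omega> Y w i)"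
  unfolding Lag_eq_halfspaces by (intro compact_Int_closed closed_INT ballI closed_halfspace_le)

lemma convex_Lag: "convex \<Omega> \<Longrightarrow> convex (Lag \<Omega> Y w i)"
  unfolding Lag_eq_halfspaces by (intro convex_Int convex_INT ballI convex_halfspace_le)

lemma lmeasurable_Lag: "compact \<Omega> \<Longrightarrow> Lag \<Omega> Y w i \<in> lmeasurable"
  by (intro lmeasurable_compact compact_Lag)

text \<open>On a common point two affine constraints become equalities, and the hyperplane so
  described has a nonzero normal because the seeds differ.\<close>

lemma negligible_Lag_Int:
  assumes "Y \<in> distinct_seeds" "i \<noteq> j"
  shows "negligible (Lag \<Omega> Y w i \<inter> Lag \<Omega> Y w j)"
proof -
  let ?a = "2 *\<^sub>R (Y $ j - Y $ i)" and ?b = "(norm (Y $ j))\<^sup>2 - w $ j - (norm (Y $ i))\<^sup>2 + w $ i"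
  have "?a \<noteq> 0" using assms by (auto simp: distinct_seeds_def)
  then have "negligible {x. ?a \<bullet> x = ?b}" by (intro negligible_hyperplane) auto
  moreover have "Lag \<Omega> Y w i \<inter> Lag \<Omega> Y w j \<subseteq> {x. ?a \<bullet> x = ?b}"
  proof
    fix x assume "x \<in> Lag \<Omega> Y w i \<inter> Lag \<Omega> Y w j"
    then have "(norm (x - Y $ i))\<^sup>2 - w $ i = (norm (x - Y $ j))\<^sup>2 - w $ j"
      by (auto simp: Lag_def intro: antisym)
    then show "x \<in> {x. ?a \<bullet> x = ?b}"
      by (simp add: power2_norm_eq_inner algebra_simps inner_commute)
  qed
  ultimately show ?thesis by (rule negligible_subset)
qed

section \<open>Laguerre cells as a partition\<close>

text \<open>Cells may share boundary points; giving ties to the least index turns them into a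
  genuine partition of \<Omega>.\<close>

definition lag_select ::
    "(real ^ 'd) set \<Rightarrow> (real ^ 'd) ^ ('n::{finite,linorder}) \<Rightarrow> real ^ ('n::{finite,linorder}) \<Rightarrow> real ^ 'd \<Rightarrow> 'n" where
  "lag_select \<Omega> Y w x = Min {i. x \<in> Lag \<Omega> Y w i}"

lemma lag_select_mem:
  fixes Y :: "(real ^ 'd) ^ ('n::{finite,linorder})"
  assumes "x \<in> \<Omega>"
  shows "x \<in> Lag \<Omega> Y w (lag_select \<Omega> Y w x)"
proof -
  let ?F = "\<lambda>j. (norm (x - Y $ j))\<^sup>2 - w $ j"
  have "Min (range ?F) \<in> range ?F" by (intro Min_in) auto
  then obtain i where "Min (range ?F) = ?F i" by (rule imageE)
  then have "x \<in> Lag \<Omega> Y w i"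
    using assms Min_le[of "range ?F"] by (auto simp: Lag_def)
  then have "Min {i. x \<in> Lag \<Omega> Y w i} \<in> {i. x \<in> Lag \<Omega> Y w i}" by (intro Min_in) auto
  then show ?thesis by (simp add: lag_select_def)
qed

text \<open>A point of cell i that is assigned elsewhere lies in a second cell as well, hence in one
  of finitely many negligible intersections.\<close>

lemma lag_select_fibre:
  fixes Y :: "(real ^ 'd) ^ ('n::{finite,linorder})"
  assumes "compact \<Omega>" "Y \<in> distinct_seeds"
  shows "{x \<in> \<Omega>. lag_select \<Omega> Y w x = i} \<subseteq> Lag \<Omega> Y w i" (is "?S i \<subseteq> _")
    and "negligible (Lag \<Omega> Y w i - {x \<in> \<Omega>. lag_select \<Omega> Y w x = i})"
    and "{x \<in> \<Omega>. lag_select \<Omega> Y w x = i} \<in> lmeasurable"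
    and "vol {x \<in> \<Omega>. lag_select \<Omega> Y w x = i} = vol (Lag \<Omega> Y w i)"
proof -
  show sub: "?S i \<subseteq> Lag \<Omega> Y w i"
    using lag_select_mem[of _ \<Omega> Y w] by auto
  have "Lag \<Omega> Y w i - ?S i \<subseteq> (\<Union>j\<in>UNIV - {i}. Lag \<Omega> Y w i \<inter> Lag \<Omega> Y w j)"
    using lag_select_mem[of _ \<Omega> Y w] by (auto simp: Lag_def)
  moreover have "negligible (\<Union>j\<in>UNIV - {i}. Lag \<Omega> Y w i \<inter> Lag \<Omega> Y w j)"
    using assms(2) by (intro negligible_Union) (auto intro: negligible_Lag_Int)
  ultimately show neg: "negligible (Lag \<Omega> Y w i - ?S i)"
    by (rule negligible_subset[rotated])
  have "Lag \<Omega> Y w i - (Lag \<Omega> Y w i - ?S i) \<in> lmeasurable"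
    using neg assms by (intro fmeasurable_Diff lmeasurable_Lag) (auto intro: fmeasurableD negligible_imp_measurable)
  moreover have "Lag \<Omega> Y w i - (Lag \<Omega> Y w i - ?S i) = ?S i" using sub by auto
  ultimately show "?S i \<in> lmeasurable" by simp
  show "vol (?S i) = vol (Lag \<Omega> Y w i)"
    unfolding vol_def
    using neg sub assms by (intro measure_negligible_symdiff lmeasurable_Lag) (auto simp: Un_absorb2 Diff_eq_empty_iff[THEN iffD2])
qed

lemma lag_select_assignment:
  fixes Y :: "(real ^ 'd) ^ ('n::{finite,linorder})"
  assumes "compact \<Omega>" "Y \<in> distinct_seeds" "\<And>i. vol (Lag \<Omega> Y w i) = v $ i"
  shows "lag_select \<Omega> Y w \<in> assignments \<Omega> v"
  using assms lag_select_fibre(3,4)[OF assms(1,2), of w] by (auto simp: assignments_def fmeasurableD)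

text \<open>Fibres may be replaced by cells up to null sets, and the integral of x over a cell is
  its volume times its centroid. This identifies the linear term of \<open>H\<close> that contains
  the centroids.\<close>

lemma integral_lag_select:
  fixes Y Z :: "(real ^ 'd) ^ ('n::{finite,linorder})"
  assumes "compact \<Omega>" "Y \<in> distinct_seeds" "\<And>i. vol (Lag \<Omega> Y w i) > 0"
  shows "(\<integral>x. x \<bullet> Z $ lag_select \<Omega> Y w x \<partial>lebesgue_on \<Omega>) =
    (\<Sum>i\<in>UNIV. vol (Lag \<Omega> Y w i) * (Z $ i \<bullet> centroid (Lag \<Omega> Y w i)))"
proof -
  let ?S = "\<lambda>i. {x \<in> \<Omega>. lag_select \<Omega> Y w x = i}"
  have "lag_select \<Omega> Y w \<in> assignments \<Omega> (\<chi> i. vol (Lag \<Omega> Y w i))"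
    using assms by (intro lag_select_assignment) auto
  then have "(\<integral>x. x \<bullet> Z $ lag_select \<Omega> Y w x \<partial>lebesgue_on \<Omega>) =
      (\<Sum>i\<in>UNIV. \<integral>x. x \<bullet> Z $ i \<partial>lebesgue_on (?S i))"
    using assms(1) by (intro assignment_integrable(2)[where f = "\<lambda>i x. x \<bullet> Z $ i"]) (auto intro!: continuous_intros)
  also have "\<dots> = (\<Sum>i\<in>UNIV. vol (Lag \<Omega> Y w i) * (Z $ i \<bullet> centroid (Lag \<Omega> Y w i)))"
  proof (intro sum.cong refl)
    fix i :: 'n
    note fib = lag_select_fibre[OF assms(1,2), of w i]
    have meas: "(\<lambda>x. indicat_real A x * (x \<bullet> Z $ i)) \<in> borel_measurable lebesgue" if "A \<in> sets lebesgue" for A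
      using that by (intro borel_measurable_times borel_measurable_indicator measurable_completion) simp_all
    have "(\<integral>x. x \<bullet> Z $ i \<partial>lebesgue_on (?S i)) = (\<integral>x. indicat_real (?S i) x *\<^sub>R (x \<bullet> Z $ i) \<partial>lebesgue)"
      using fib by (subst integral_restrict_space) (auto simp: fmeasurableD)
    also have "\<dots> = (\<integral>x. indicat_real (Lag \<Omega> Y w i) x *\<^sub>R (x \<bullet> Z $ i) \<partial>lebesgue)"
    proof (rule integral_cong_AE)
      have "AE x in lebesgue. x \<notin> Lag \<Omega> Y w i - ?S i"
        using fib(2) by (intro AE_not_in) (simp add: negligible_iff_null_sets)
      then show "AE x in lebesgue. indicat_real (?S i) x *\<^sub>R (x \<bullet> Z $ i) =
          indicat_real (Lag \<Omega> Y w i) x *\<^sub>R (x \<bullet> Z $ i)"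
        by eventually_elim (use fib(1) in \<open>auto simp: indicator_def\<close>)
    qed (use fib lmeasurable_Lag[OF assms(1), of Y w i] in \<open>auto intro!: meas simp: fmeasurableD\<close>)
    also have "\<dots> = (\<integral>x. x \<bullet> Z $ i \<partial>lebesgue_on (Lag \<Omega> Y w i))"
      using lmeasurable_Lag[OF assms(1), of Y w i] by (subst integral_restrict_space) (auto simp: fmeasurableD)
    also have "\<dots> = (\<integral>x. x \<partial>lebesgue_on (Lag \<Omega> Y w i)) \<bullet> Z $ i"
      by (intro integral_inner_left integrable_continuous_on_compact compact_Lag assms continuous_on_id)
    also have "\<dots> = vol (Lag \<Omega> Y w i) * (Z $ i \<bullet> centroid (Lag \<Omega> Y w i))"
      using assms(3)[of i] by (simp add: centroid_def inner_commute)
    finally show "(\<integral>x. x \<bullet> Z $ i \<partial>lebesgue_on (?S i)) = vol (Lag \<Omega> Y w i) * (Z $ i \<bullet> centroid (Lag \<Omega> Y w i))" .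
  qed
  finally show ?thesis .
qed

section \<open>Optimality and its equality case\<close>

text \<open>At every point t picks an index of least weighted cost, and integration preserves the
  comparison because the weights contribute equally to s and t. In the equality case a nonnegative
  function has integral zero, so s also picks a minimising index almost everywhere.\<close>

lemma Lag_optimal:
  fixes Y :: "(real ^ 'd) ^ 'n::finite"
  assumes \<Omega>: "compact \<Omega>" and s: "s \<in> assignments \<Omega> v" and t: "t \<in> assignments \<Omega> v"
    and Lag: "\<And>x. x \<in> \<Omega> \<Longrightarrow> x \<in> Lag \<Omega> Y w (t x)"
  shows "(\<integral>x. x \<bullet> Y $ s x \<partial>lebesgue_on \<Omega>) \<le> (\<integral>x. x \<bullet> Y $ t x \<partial>lebesgue_on \<Omega>)"
    and "(\<integral>x. x \<bullet> Y $ s x \<partial>lebesgue_on \<Omega>) = (\<integral>x. x \<bullet> Y $ t x \<partial>lebesgue_on \<Omega>)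
      \<Longrightarrow> AE x in lebesgue_on \<Omega>. x \<in> Lag \<Omega> Y w (s x)"
proof -
  \<comment> \<open>\<open>F\<close> is the weighted cost without the common term
    \<open>(norm x)\<^sup>2\<close>. It has the same minimising indices but is affine in x.\<close>
  define c where "c i = (norm (Y $ i))\<^sup>2 - w $ i" for i
  define F where "F i x = c i - 2 * (x \<bullet> Y $ i)" for i x
  have F: "F i x = (norm (x - Y $ i))\<^sup>2 - w $ i - (norm x)\<^sup>2" for i x
    by (simp add: F_def c_def power2_norm_eq_inner algebra_simps inner_commute)
  have Lag_F: "x \<in> Lag \<Omega> Y w i \<longleftrightarrow> x \<in> \<Omega> \<and> (\<forall>j. F i x \<le> F j x)" for x i
    by (simp add: Lag_def F)
  have int: "integrable (lebesgue_on \<Omega>) (\<lambda>x. F (r x) x)"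
    "(\<integral>x. F (r x) x \<partial>lebesgue_on \<Omega>) = (\<Sum>i\<in>UNIV. v $ i * c i) - 2 * (\<integral>x. x \<bullet> Y $ r x \<partial>lebesgue_on \<Omega>)"
    if r: "r \<in> assignments \<Omega> v" for r
  proof -
    show "integrable (lebesgue_on \<Omega>) (\<lambda>x. F (r x) x)"
      unfolding F_def by (intro assignment_integrable(1)[OF r \<Omega>, where f = F, unfolded F_def]) (auto intro!: continuous_intros)
    have "integrable (lebesgue_on \<Omega>) (\<lambda>x. c (r x))"
      by (intro assignment_integrable(1)[OF r \<Omega>, where f = "\<lambda>i x. c i"]) auto
    moreover have "integrable (lebesgue_on \<Omega>) (\<lambda>x. x \<bullet> Y $ r x)"
      by (intro assignment_integrable(1)[OF r \<Omega>, where f = "\<lambda>i x. x \<bullet> Y $ i"]) (auto intro!: continuous_intros)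
    ultimately show "(\<integral>x. F (r x) x \<partial>lebesgue_on \<Omega>) = (\<Sum>i\<in>UNIV. v $ i * c i) - 2 * (\<integral>x. x \<bullet> Y $ r x \<partial>lebesgue_on \<Omega>)"
      by (simp add: F_def assignment_integral_const[OF r \<Omega>])
  qed
  have le: "F (t x) x \<le> F (s x) x" if "x \<in> \<Omega>" for x
    using Lag[OF that] by (simp add: Lag_F)
  have diff: "(\<integral>x. F (s x) x - F (t x) x \<partial>lebesgue_on \<Omega>) =
      2 * ((\<integral>x. x \<bullet> Y $ t x \<partial>lebesgue_on \<Omega>) - (\<integral>x. x \<bullet> Y $ s x \<partial>lebesgue_on \<Omega>))"
    using int[OF s] int[OF t] by simp
  have "0 \<le> (\<integral>x. F (s x) x - F (t x) x \<partial>lebesgue_on \<Omega>)"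
    using le by (intro integral_nonneg_AE AE_I2) auto
  then show "(\<integral>x. x \<bullet> Y $ s x \<partial>lebesgue_on \<Omega>) \<le> (\<integral>x. x \<bullet> Y $ t x \<partial>lebesgue_on \<Omega>)"
    unfolding diff by simp
  assume "(\<integral>x. x \<bullet> Y $ s x \<partial>lebesgue_on \<Omega>) = (\<integral>x. x \<bullet> Y $ t x \<partial>lebesgue_on \<Omega>)"
  then have "(\<integral>x. F (s x) x - F (t x) x \<partial>lebesgue_on \<Omega>) = 0" unfolding diff by simp
  then have "AE x in lebesgue_on \<Omega>. F (s x) x - F (t x) x = 0"
    using int(1)[OF s] int(1)[OF t] le
    by (subst integral_nonneg_eq_0_iff_AE[symmetric]) (auto intro!: AE_I2)
  moreover have "AE x in lebesgue_on \<Omega>. x \<in> \<Omega>" by (intro AE_I2) simp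
  ultimately show "AE x in lebesgue_on \<Omega>. x \<in> Lag \<Omega> Y w (s x)"
    by eventually_elim (use Lag in \<open>auto simp: Lag_F\<close>)
qed

text \<open>The interior of C minus K is open and negligible, hence empty; since C is convex with
  nonempty interior, it lies in the closure of that interior.\<close>

lemma convex_closed_subset_of_negligible_Diff:
  fixes C K :: "'a::euclidean_space set"
  assumes "convex C" "\<not> negligible C" "closed K" "negligible (C - K)"
  shows "C \<subseteq> K"
proof -
  have "interior C \<noteq> {}" using assms negligible_convex_interior by blast
  have "negligible (interior C - K)"
    using assms(4) by (rule negligible_subset) (use interior_subset in blast)
  then have "interior C - K = {}"
    using open_not_negligible[of "interior C - K"] assms(3) by (auto simp: open_Diff)
  then have "closure (interior C) \<subseteq> K"
    using assms(3) by (intro closure_minimal) auto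
  then show ?thesis
    using convex_closure_interior[OF assms(1) \<open>interior C \<noteq> {}\<close>] closure_subset by blast
qed

text \<open>The partition of X is optimal for the seeds Y, so the equality case of
  \<open>Lag_optimal\<close> puts each cell of X almost everywhere inside the corresponding cell of
  Y. Convexity makes this a true inclusion, and equal volumes then give the reverse one.\<close>

lemma Lag_eq_of_optimal:
  fixes X Y :: "(real ^ 'd) ^ ('n::{finite,linorder})"
  assumes \<Omega>: "compact \<Omega>" "convex \<Omega>" and X: "X \<in> distinct_seeds" and Y: "Y \<in> distinct_seeds"
    and v: "\<And>i. 0 < v $ i"
    and volX: "\<And>i. vol (Lag \<Omega> X w i) = v $ i" and volY: "\<And>i. vol (Lag \<Omega> Y w' i) = v $ i"
    and opt: "(\<integral>x. x \<bullet> Y $ lag_select \<Omega> Y w' x \<partial>lebesgue_on \<Omega>)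
      \<le> (\<integral>x. x \<bullet> Y $ lag_select \<Omega> X w x \<partial>lebesgue_on \<Omega>)"
  shows "Lag \<Omega> X w i = Lag \<Omega> Y w' i"
proof -
  let ?L = "Lag \<Omega> X w i" and ?L' = "Lag \<Omega> Y w' i" and ?S = "{x \<in> \<Omega>. lag_select \<Omega> X w x = i}"
  have \<Omega>_sets: "\<Omega> \<in> sets lebesgue" using \<Omega> by (auto intro: fmeasurableD lmeasurable_compact)
  have "AE x in lebesgue_on \<Omega>. x \<in> Lag \<Omega> Y w' (lag_select \<Omega> X w x)"
    using Lag_optimal[OF \<Omega>(1) lag_select_assignment[OF \<Omega>(1) X volX]
        lag_select_assignment[OF \<Omega>(1) Y volY] lag_select_mem] opt
    by (meson antisym)
  then have "AE x in lebesgue. x \<in> \<Omega> \<longrightarrow> x \<in> Lag \<Omega> Y w' (lag_select \<Omega> X w x)"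
    using \<Omega>_sets by (simp add: AE_restrict_space_iff)
  then have "AE x in lebesgue. x \<notin> ?S - ?L'" by eventually_elim auto
  then have "negligible (?S - ?L')"
    using lag_select_fibre(3)[OF \<Omega>(1) X, of w i] lmeasurable_Lag[OF \<Omega>(1), of Y w' i]
    by (auto simp: negligible_iff_null_sets AE_iff_null_sets fmeasurableD)
  then have "negligible ((?S - ?L') \<union> (?L - ?S))"
    using lag_select_fibre(2)[OF \<Omega>(1) X, of w i] by (simp add: negligible_Un)
  then have "negligible (?L - ?L')"
    by (rule negligible_subset) auto
  moreover have nn: "\<not> negligible ?L" "\<not> negligible ?L'"
    using v[of i] volX[of i] volY[of i] by (auto simp: vol_def dest: negligible_imp_measure0)
  ultimately have sub: "?L \<subseteq> ?L'"
    using \<Omega> by (intro convex_closed_subset_of_negligible_Diff convex_Lag compact_imp_closed compact_Lag)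
  then have "measure lebesgue (?L' - ?L) = 0"
    using volX[of i] volY[of i] lmeasurable_Lag[OF \<Omega>(1)]
    by (subst measurable_measure_Diff) (auto simp: vol_def fmeasurableD)
  then have "negligible (?L' - ?L)"
    using lmeasurable_Lag[OF \<Omega>(1)] by (subst negligible_iff_measure0) (auto intro!: fmeasurable_Diff fmeasurableD)
  then have "?L' \<subseteq> ?L"
    using \<Omega> nn by (intro convex_closed_subset_of_negligible_Diff convex_Lag compact_imp_closed compact_Lag)
  with sub show ?thesis by auto
qed

section \<open>Existence and uniqueness of weights\<close>

lemma Lag_add_const: "Lag \<Omega> Y (\<chi> j. w $ j + c) i = Lag \<Omega> Y w i"
  by (auto simp: Lag_def)

lemma lag_select_cost_le:
  fixes Y :: "(real ^ 'd) ^ ('n::{finite,linorder})"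
  assumes "x \<in> \<Omega>"
  shows "(norm (x - Y $ lag_select \<Omega> Y w x))\<^sup>2 - w $ lag_select \<Omega> Y w x \<le> (norm (x - Y $ j))\<^sup>2 - w $ j"
  using lag_select_mem[OF assms, of Y w] by (auto simp: Lag_def)

lemma sum_vol_Lag:
  fixes Y :: "(real ^ 'd) ^ ('n::{finite,linorder})"
  assumes "compact \<Omega>" "Y \<in> distinct_seeds"
  shows "(\<Sum>i\<in>UNIV. vol (Lag \<Omega> Y w i)) = vol \<Omega>"
proof -
  have "lag_select \<Omega> Y w \<in> assignments \<Omega> (\<chi> i. vol (Lag \<Omega> Y w i))"
    using assms by (intro lag_select_assignment) auto
  from assignment_integral_const[OF this assms(1), of "\<lambda>_. 1"] show ?thesis
    using lmeasurable_compact[OF assms(1)]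
    by (simp add: vol_def measure_restrict_space fmeasurableD)
qed

text \<open>For t = 1/(k+1) the enlarged cells decrease to the cell at w, so their volumes converge.
  In \<open>exists_weights\<close> maximality bounds only the enlarged cells, and this lemma removes
  the perturbation.\<close>

lemma vol_Lag_semicontinuous:
  fixes Y :: "(real ^ 'd) ^ ('n::{finite,linorder})"
  assumes "compact \<Omega>" and le: "\<And>t. 0 < t \<Longrightarrow> c \<le> vol (Lag \<Omega> Y (w + axis i t) i)"
  shows "c \<le> vol (Lag \<Omega> Y w i)"
proof -
  define A where "A k = Lag \<Omega> Y (w + axis i (1 / real (Suc k))) i" for k
  have mem: "x \<in> Lag \<Omega> Y (w + axis i t) i \<longleftrightarrow>
      x \<in> \<Omega> \<and> (\<forall>j. j \<noteq> i \<longrightarrow> (norm (x - Y $ i))\<^sup>2 - w $ i \<le> (norm (x - Y $ j))\<^sup>2 - w $ j + t)" for x t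
    by (auto simp: Lag_def axis_def algebra_simps)
  have "decseq A"
  proof (intro decseq_SucI subsetI)
    fix k x assume x: "x \<in> A (Suc k)"
    have "1 / real (Suc (Suc k)) \<le> 1 / real (Suc k)" by (simp add: divide_simps)
    then show "x \<in> A k"
      using x unfolding A_def mem by (meson add_left_mono order_trans)
  qed
  moreover have "A k \<in> lmeasurable" for k
    unfolding A_def by (rule lmeasurable_Lag[OF assms(1)])
  ultimately have "(\<lambda>k. measure lebesgue (A k)) \<longlonglongrightarrow> measure lebesgue (\<Inter>k. A k)"
    by (intro Lim_measure_decseq) (auto simp: fmeasurableD fmeasurableD2 simp del: emeasure_completion)
  moreover have "(\<Inter>k. A k) = Lag \<Omega> Y w i"
  proof (intro subset_antisym subsetI)
    fix x assume x: "x \<in> (\<Inter>k. A k)"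
    show "x \<in> Lag \<Omega> Y w i"
      unfolding Lag_def
    proof (intro CollectI conjI allI)
      show "x \<in> \<Omega>" using x by (auto simp: A_def mem)
      fix j
      have *: "(\<lambda>k. (norm (x - Y $ j))\<^sup>2 - w $ j + 1 / real (Suc k)) \<longlonglongrightarrow> (norm (x - Y $ j))\<^sup>2 - w $ j + 0"
        by (intro tendsto_intros LIMSEQ_Suc[OF lim_1_over_n])
      show "(norm (x - Y $ i))\<^sup>2 - w $ i \<le> (norm (x - Y $ j))\<^sup>2 - w $ j"
        using x LIMSEQ_le_const[OF *, of "(norm (x - Y $ i))\<^sup>2 - w $ i"]
        by (cases "j = i") (auto simp: A_def mem)
    qed
  next
    fix x assume x: "x \<in> Lag \<Omega> Y w i"
    have "x \<in> A k" for k
      unfolding A_def mem using x by (auto simp: Lag_def intro: add_increasing2)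
    then show "x \<in> (\<Inter>k. A k)" by blast
  qed
  ultimately show ?thesis
    using le by (intro LIMSEQ_le_const[of "\<lambda>k. measure lebesgue (A k)"]) (auto simp: vol_def A_def)
qed

text \<open>
  The weights maximise the Kantorovich dual functional
  \<open>g w = \<integral>\<^bsub>\<Omega>\<^esub> min\<^sub>j (|x - y\<^sub>j|\<^sup>2 - w\<^sub>j) + \<Sum>j. v\<^sub>j w\<^sub>j\<close>. It is invariant under adding constants to \<open>w\<close> and
  coercive modulo constants. Raising \<open>w\<^sub>i\<close> by \<open>t\<close> changes \<open>g\<close> by at least \<open>t (v\<^sub>i - vol Lag\<^sub>i)\<close> with the
  new cell, so at a maximiser every cell has volume at least \<open>v\<^sub>i\<close>; the volumes having the same
  sum, equality holds.
\<close>

lemma exists_weights: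
  fixes Y :: "(real ^ 'd) ^ ('n::{finite,linorder})" and v :: "real ^ ('n::{finite,linorder})"
  assumes \<Omega>: "compact \<Omega>" and Y: "Y \<in> distinct_seeds" and v: "\<And>i. 0 < v $ i"
    and sum_v: "(\<Sum>i\<in>UNIV. v $ i) = vol \<Omega>"
  shows "\<exists>w. \<forall>i. vol (Lag \<Omega> Y w i) = v $ i"
proof -
  have \<Omega>_sets: "\<Omega> \<in> sets lebesgue" using \<Omega> by (auto intro: fmeasurableD lmeasurable_compact)
  interpret finite_measure "lebesgue_on \<Omega>"
    using \<Omega> by (intro finite_measure_lebesgue_on lmeasurable_compact)
  have meas_\<Omega>: "measure (lebesgue_on \<Omega>) \<Omega> = vol \<Omega>"
    using \<Omega>_sets by (simp add: vol_def measure_restrict_space)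
  define F where "F w j x = (norm (x - Y $ j))\<^sup>2 - w $ j" for w :: "real ^ ('n::{finite,linorder})" and j x
  \<comment> \<open>The pointwise minimum of the costs, written through \<open>lag_select\<close> so
    that integrability follows from that of assignments.\<close>
  define \<phi> where "\<phi> w x = F w (lag_select \<Omega> Y w x) x" for w x
  define g where "g w = (\<integral>x. \<phi> w x \<partial>lebesgue_on \<Omega>) + (\<Sum>j\<in>UNIV. v $ j * w $ j)" for w
  have \<phi>_le: "\<phi> w x \<le> F w j x" if "x \<in> \<Omega>" for w x j
    unfolding \<phi>_def F_def using that by (rule lag_select_cost_le)
  have \<phi>_Lag: "\<phi> w x = F w j x" if "x \<in> Lag \<Omega> Y w j" for w x j
    using that \<phi>_le[of x w j] by (intro antisym) (auto simp: \<phi>_def F_def Lag_def)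
  have cont: "continuous_on \<Omega> (F w j)" for w j
    unfolding F_def by (intro continuous_intros)
  have int: "integrable (lebesgue_on \<Omega>) (\<phi> w)" for w
    unfolding \<phi>_def
    by (rule assignment_integrable(1)[OF lag_select_assignment[OF \<Omega> Y, of w "\<chi> i. vol (Lag \<Omega> Y w i)"] \<Omega> cont]) simp
  \<comment> \<open>Each of the two terms contributes vol \<Omega>: a minimum moves by at most the
    largest change of a weight, and the masses v sum to vol \<Omega>.\<close>
  have g_lip: "g w \<le> g w' + 2 * vol \<Omega> * norm (w - w')" for w w'
  proof -
    have w: "w' $ j - w $ j \<le> norm (w - w')" "w $ j - w' $ j \<le> norm (w - w')" for j
      using component_le_norm_cart[of "w - w'" j] by auto
    have "\<phi> w x \<le> \<phi> w' x + norm (w - w')" if "x \<in> \<Omega>" for x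
      using \<phi>_le[OF that, of w "lag_select \<Omega> Y w' x"] w(1)[of "lag_select \<Omega> Y w' x"]
      unfolding \<phi>_def F_def by linarith
    then have "(\<integral>x. \<phi> w x \<partial>lebesgue_on \<Omega>) \<le> (\<integral>x. \<phi> w' x + norm (w - w') \<partial>lebesgue_on \<Omega>)"
      using int by (intro integral_mono) auto
    also have "\<dots> = (\<integral>x. \<phi> w' x \<partial>lebesgue_on \<Omega>) + vol \<Omega> * norm (w - w')"
      using int by (simp add: meas_\<Omega>)
    finally have 1: "(\<integral>x. \<phi> w x \<partial>lebesgue_on \<Omega>) \<le> \<dots>" .
    have "(\<Sum>j\<in>UNIV. v $ j * w $ j) - (\<Sum>j\<in>UNIV. v $ j * w' $ j) = (\<Sum>j\<in>UNIV. v $ j * (w $ j - w' $ j))"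
      by (simp add: sum_subtractf algebra_simps)
    also have "\<dots> \<le> (\<Sum>j\<in>UNIV. v $ j * norm (w - w'))"
      using v w(2) by (intro sum_mono mult_left_mono) (auto intro: less_imp_le)
    also have "\<dots> = vol \<Omega> * norm (w - w')" by (simp add: sum_v flip: sum_distrib_right)
    finally show ?thesis using 1 unfolding g_def by linarith
  qed
  have g_cont: "continuous_on S g" for S
  proof (rule lipschitz_on_continuous_on)
    show "(2 * vol \<Omega>)-lipschitz_on S g"
    proof (rule lipschitz_onI)
      fix w w' show "dist (g w) (g w') \<le> 2 * vol \<Omega> * dist w w'"
        using g_lip[of w w'] g_lip[of w' w] by (auto simp: dist_norm norm_minus_commute abs_le_iff)
    qed (simp add: vol_def)
  qed
  have g_shift: "g (\<chi> j. w $ j + c) = g w" for w c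
  proof -
    have "\<phi> (\<chi> j. w $ j + c) x = \<phi> w x - c" for x
      by (simp add: \<phi>_def F_def lag_select_def Lag_add_const)
    then have "(\<integral>x. \<phi> (\<chi> j. w $ j + c) x \<partial>lebesgue_on \<Omega>) = (\<integral>x. \<phi> w x \<partial>lebesgue_on \<Omega>) - vol \<Omega> * c"
      using int by (simp add: meas_\<Omega>)
    moreover have "(\<Sum>j\<in>UNIV. v $ j * (\<chi> j. w $ j + c) $ j) = (\<Sum>j\<in>UNIV. v $ j * w $ j) + vol \<Omega> * c"
      by (simp add: distrib_left sum.distrib sum_v flip: sum_distrib_right)
    ultimately show ?thesis by (simp add: g_def)
  qed
  define I where "I k = (\<integral>x. (norm (x - Y $ k))\<^sup>2 \<partial>lebesgue_on \<Omega>)" for k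
  define C where "C = (\<Sum>k\<in>UNIV. I k)"
  have g_coercive: "g w \<le> C + v $ l * w $ l" if "w $ k = 0" "\<And>j. w $ j \<le> 0" for w k l
  proof -
    have "(\<integral>x. \<phi> w x \<partial>lebesgue_on \<Omega>) \<le> I k"
      unfolding I_def using int \<phi>_le[of _ w k] that(1)
      by (intro integral_mono integrable_continuous_on_compact[OF \<Omega>, of "\<lambda>x. (norm (x - Y $ k))\<^sup>2"] continuous_intros)
        (auto simp: F_def)
    also have "I k \<le> C"
      unfolding C_def by (intro member_le_sum) (auto simp: I_def intro!: integral_nonneg_AE)
    finally have 1: "(\<integral>x. \<phi> w x \<partial>lebesgue_on \<Omega>) \<le> C" .
    have "(\<Sum>j\<in>UNIV. v $ j * w $ j) = v $ l * w $ l + (\<Sum>j\<in>UNIV - {l}. v $ j * w $ j)"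
      by (subst sum.remove[of _ l]) auto
    also have "(\<Sum>j\<in>UNIV - {l}. v $ j * w $ j) \<le> 0"
      using that(2) v by (intro sum_nonpos mult_nonneg_nonpos) (auto intro: less_imp_le)
    finally show ?thesis using 1 unfolding g_def by linarith
  qed
  \<comment> \<open>M dominates every ratio \<open>\<bar>C - g 0\<bar> / v $ l\<close>, so by
    coercivity a normalised weight vector with a component below - M does no better than 0.\<close>
  define M where "M = (\<Sum>l\<in>UNIV. \<bar>C - g 0\<bar> / v $ l)"
  have M0: "0 \<le> M" unfolding M_def using v by (intro sum_nonneg divide_nonneg_pos) auto
  have M: "C - v $ l * M \<le> g 0" for l
  proof -
    have "\<bar>C - g 0\<bar> / v $ l \<le> M"
      unfolding M_def using v by (intro member_le_sum divide_nonneg_pos) auto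
    then have "\<bar>C - g 0\<bar> \<le> v $ l * M" using v[of l] by (simp add: divide_simps mult.commute)
    then show ?thesis by linarith
  qed
  let ?K = "cbox (\<chi> j. - M) 0 :: (real ^ ('n::{finite,linorder})) set"
  have K: "w \<in> ?K \<longleftrightarrow> (\<forall>j. - M \<le> w $ j \<and> w $ j \<le> 0)" for w
    by (simp add: mem_box_cart)
  have "0 \<in> ?K" using M0 by (simp add: K)
  then obtain w0 where w0: "w0 \<in> ?K" "\<And>w. w \<in> ?K \<Longrightarrow> g w \<le> g w0"
    using continuous_attains_sup[OF compact_cbox _ g_cont, of "\<chi> j. - M" 0] by auto
  have max: "g w \<le> g w0" for w
  proof -
    have "Max (range (($) w)) \<in> range (($) w)" by (intro Max_in) auto
    then obtain k where k: "Max (range (($) w)) = w $ k" by (rule imageE)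
    have wk: "w $ j \<le> w $ k" for j using Max_ge[of "range (($) w)" "w $ j"] k by auto
    \<comment> \<open>Shifting the largest component to 0 leaves g unchanged. Then u lies in the
      box, or some component is below - M and the choice of M applies.\<close>
    define u where "u = (\<chi> j. w $ j + (- w $ k))"
    have gu: "g u = g w" unfolding u_def by (rule g_shift)
    have u: "u $ k = 0" "\<And>j. u $ j \<le> 0" using wk by (auto simp: u_def)
    show ?thesis
    proof (cases "u \<in> ?K")
      case True
      then show ?thesis using w0(2) gu by metis
    next
      case False
      then obtain l where l: "u $ l < - M" using u(2) by (auto simp: K not_le)
      have "g u \<le> C + v $ l * u $ l" by (rule g_coercive[OF u])
      also have "\<dots> \<le> C - v $ l * M"
        using l v[of l] mult_left_mono[of "u $ l" "- M" "v $ l"] by simp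
      also have "\<dots> \<le> g w0" using M[of l] w0(2)[OF \<open>0 \<in> ?K\<close>] by linarith
      finally show ?thesis using gu by simp
    qed
  qed
  have "v $ i \<le> vol (Lag \<Omega> Y w0 i)" for i
  proof (rule vol_Lag_semicontinuous[OF \<Omega>])
    fix t :: real assume t: "0 < t"
    let ?w = "w0 + axis i t"
    let ?L = "Lag \<Omega> Y ?w i"
    have L: "?L \<in> sets lebesgue" using lmeasurable_Lag[OF \<Omega>] by (rule fmeasurableD)
    then have L': "?L \<in> sets (lebesgue_on \<Omega>)"
      using \<Omega>_sets Lag_subset[of \<Omega> Y ?w i] by (simp add: sets_restrict_space_iff)
    \<comment> \<open>In the new cell the cost of i is minimal and has dropped by exactly t;
      elsewhere the selected index differs from i and its cost is unchanged.\<close>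
    have "\<phi> w0 x - t * indicat_real ?L x \<le> \<phi> ?w x" if x: "x \<in> \<Omega>" for x
    proof (cases "x \<in> ?L")
      case True
      then show ?thesis using \<phi>_le[OF x, of w0 i] \<phi>_Lag[OF True] by (simp add: F_def)
    next
      case False
      then have "lag_select \<Omega> Y ?w x \<noteq> i" using lag_select_mem[OF x, of Y ?w] by auto
      then have "\<phi> ?w x = F w0 (lag_select \<Omega> Y ?w x) x"
        by (simp add: \<phi>_def F_def axis_def)
      then show ?thesis using \<phi>_le[OF x, of w0] False by simp
    qed
    then have "(\<integral>x. \<phi> w0 x - t * indicat_real ?L x \<partial>lebesgue_on \<Omega>) \<le> (\<integral>x. \<phi> ?w x \<partial>lebesgue_on \<Omega>)"
      using int L' by (intro integral_mono) (auto intro!: Bochner_Integration.integrable_diff integrable_real_indicator simp: less_top[symmetric])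
    also have "(\<integral>x. \<phi> w0 x - t * indicat_real ?L x \<partial>lebesgue_on \<Omega>) = (\<integral>x. \<phi> w0 x \<partial>lebesgue_on \<Omega>) - t * vol ?L"
      using int L' Lag_subset[of \<Omega> Y ?w i] \<Omega>_sets
      by (subst Bochner_Integration.integral_diff)
        (auto intro!: integrable_real_indicator simp: less_top[symmetric] vol_def measure_restrict_space Int_absorb2)
    finally have 1: "(\<integral>x. \<phi> w0 x \<partial>lebesgue_on \<Omega>) - t * vol ?L \<le> (\<integral>x. \<phi> ?w x \<partial>lebesgue_on \<Omega>)" .
    have "(\<Sum>j\<in>UNIV. v $ j * ?w $ j) = (\<Sum>j\<in>UNIV. v $ j * w0 $ j + (if j = i then v $ i * t else 0))"
      by (intro sum.cong) (auto simp: axis_def algebra_simps)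
    also have "\<dots> = (\<Sum>j\<in>UNIV. v $ j * w0 $ j) + v $ i * t"
      by (simp add: sum.distrib)
    finally have "g ?w \<ge> g w0 - t * vol ?L + v $ i * t"
      using 1 by (simp add: g_def)
    then have "t * v $ i \<le> t * vol ?L" using max[of ?w] by (simp add: algebra_simps)
    then show "v $ i \<le> vol ?L" using t by simp
  qed
  then have "v $ i = vol (Lag \<Omega> Y w0 i)" for i
    by (intro sum_mono_inv[of "($) v" UNIV "\<lambda>i. vol (Lag \<Omega> Y w0 i)"])
      (auto simp: sum_v sum_vol_Lag[OF \<Omega> Y])
  then show ?thesis by metis
qed

text \<open>
  Both weights give the same cells, and on a common point of two cells their difference is determined
  by the seeds. Since \<open>\<Omega>\<close> is connected, its cells cannot be split into two groups without a common point.
\<close>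

lemma weights_unique:
  fixes Y :: "(real ^ 'd) ^ ('n::{finite,linorder})"
  assumes \<Omega>: "compact \<Omega>" "convex \<Omega>" and Y: "Y \<in> distinct_seeds" and v: "\<And>i. 0 < v $ i"
    and vol: "\<And>i. vol (Lag \<Omega> Y w i) = v $ i" "\<And>i. vol (Lag \<Omega> Y w' i) = v $ i"
    and k: "w $ k = w' $ k"
  shows "w = w'"
proof (rule ccontr)
  assume "w \<noteq> w'"
  define L where "L = Lag \<Omega> Y w"
  \<comment> \<open>One of the two partitions has at least the correlation of the other, and
    \<open>Lag_eq_of_optimal\<close> with X = Y applies in that direction.\<close>
  have L': "L = Lag \<Omega> Y w'"
  proof (cases "(\<integral>x. x \<bullet> Y $ lag_select \<Omega> Y w' x \<partial>lebesgue_on \<Omega>)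
      \<le> (\<integral>x. x \<bullet> Y $ lag_select \<Omega> Y w x \<partial>lebesgue_on \<Omega>)")
    case True
    then show ?thesis unfolding L_def by (intro ext Lag_eq_of_optimal[OF \<Omega> Y Y v vol])
  next
    case False
    then show ?thesis unfolding L_def by (intro ext Lag_eq_of_optimal[OF \<Omega> Y Y v vol(2,1), symmetric]) simp
  qed
  \<comment> \<open>Cells are grouped by whether the two weights agree: k supplies a cell of the
    first group, the assumed inequality of w and w' one of the second.\<close>
  let ?A = "\<Union>i\<in>{i. w $ i = w' $ i}. L i" and ?B = "\<Union>i\<in>{i. w $ i \<noteq> w' $ i}. L i"
  have closed: "closed ?A" "closed ?B"
    using \<Omega> by (auto simp: L_def intro!: closed_UN compact_imp_closed compact_Lag)
  have cover: "\<Omega> \<subseteq> ?A \<union> ?B"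
    using lag_select_mem[of _ \<Omega> Y w] by (auto simp: L_def)
  have "?A \<inter> ?B \<inter> \<Omega> = {}"
  proof (rule ccontr)
    assume "?A \<inter> ?B \<inter> \<Omega> \<noteq> {}"
    then obtain x i j where x: "x \<in> L i" "x \<in> L j" and ij: "w $ i = w' $ i" "w $ j \<noteq> w' $ j" by auto
    have "(norm (x - Y $ i))\<^sup>2 - w $ i = (norm (x - Y $ j))\<^sup>2 - w $ j"
      using x unfolding L_def by (auto simp: Lag_def intro: antisym)
    moreover have "(norm (x - Y $ i))\<^sup>2 - w' $ i = (norm (x - Y $ j))\<^sup>2 - w' $ j"
      using x unfolding L' by (auto simp: Lag_def intro: antisym)
    ultimately show False using ij by simp
  qed
  moreover have ne: "L i \<inter> \<Omega> \<noteq> {}" for i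
    using vol(1)[of i] v[of i] Lag_subset[of \<Omega> Y w i] by (auto simp: L_def vol_def Int_absorb2)
  have "?A \<inter> \<Omega> \<noteq> {}" using ne k by blast
  moreover have "?B \<inter> \<Omega> \<noteq> {}" using ne \<open>w \<noteq> w'\<close> by (fastforce simp: vec_eq_iff)
  ultimately show False
    using convex_connected[OF \<Omega>(2)] closed cover unfolding connected_closed by blast
qed

text \<open>Any weights with the right volumes may be shifted to satisfy the normalisation, which
  does not move the cells; uniqueness identifies the result with \<open>opt_weights\<close>.\<close>

lemma Lcell_eq:
  fixes Y :: "(real ^ 'd) ^ ('n::{finite,linorder})"
  assumes "compact \<Omega>" "convex \<Omega>" "Y \<in> distinct_seeds" "\<And>i. 0 < v $ i"
    and vol: "\<And>i. vol (Lag \<Omega> Y w i) = v $ i"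
  shows "Lcell \<Omega> Y v i = Lag \<Omega> Y w i"
proof -
  define u where "u = (\<chi> j. w $ j + (- w $ Max UNIV))"
  have Lag_u: "Lag \<Omega> Y u i = Lag \<Omega> Y w i" for i
    unfolding u_def by (rule Lag_add_const)
  have "opt_weights \<Omega> Y v = u"
    unfolding opt_weights_def
  proof (rule the_equality)
    show "u $ Max UNIV = 0 \<and> (\<forall>i. vol (Lag \<Omega> Y u i) = v $ i)"
      using vol by (simp add: Lag_u) (simp add: u_def)
    then show "u' = u" if "u' $ Max UNIV = 0 \<and> (\<forall>i. vol (Lag \<Omega> Y u' i) = v $ i)" for u'
      using that by (intro weights_unique[OF assms(1-4), where k = "Max UNIV"]) auto
  qed
  then show ?thesis by (simp add: Lcell_def Lag_u)
qed

section \<open>The functional H\<close>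

text \<open>Expanding the square, only the correlation term depends on the assignment s. The
  assumption on B rewrites the linear term of \<open>H\<close> as the correlation of r. Boundedness
  is recorded too, since bounding a real infimum by one of its members requires it.\<close>

lemma H_eq_INF:
  fixes Z :: "(real ^ 'd) ^ 'n::finite"
  assumes \<Omega>: "compact \<Omega>" and v: "\<And>i. 0 \<le> v $ i" and r: "r \<in> assignments \<Omega> v"
    and B: "(\<Sum>i\<in>UNIV. v $ i * (Z $ i \<bullet> B $ i)) = (\<integral>x. x \<bullet> Z $ r x \<partial>lebesgue_on \<Omega>)"
  shows "H \<Omega> v B Z = (INF s\<in>assignments \<Omega> v.
      (\<integral>x. x \<bullet> Z $ r x \<partial>lebesgue_on \<Omega>) - (\<integral>x. x \<bullet> Z $ s x \<partial>lebesgue_on \<Omega>))"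
    and "bdd_below ((\<lambda>s. (\<integral>x. x \<bullet> Z $ r x \<partial>lebesgue_on \<Omega>) - (\<integral>x. x \<bullet> Z $ s x \<partial>lebesgue_on \<Omega>)) ` assignments \<Omega> v)"
proof -
  define c where "c s = (\<integral>x. (norm (x - Z $ s x))\<^sup>2 \<partial>lebesgue_on \<Omega>)" for s
  define K where "K = (\<integral>x. x \<bullet> Z $ r x \<partial>lebesgue_on \<Omega>) - 1 / 2 * (\<Sum>i\<in>UNIV. v $ i * (norm (Z $ i))\<^sup>2)
      - 1 / 2 * (\<integral>x. (norm x)\<^sup>2 \<partial>lebesgue_on \<Omega>)"
  define gap where "gap s = (\<integral>x. x \<bullet> Z $ r x \<partial>lebesgue_on \<Omega>) - (\<integral>x. x \<bullet> Z $ s x \<partial>lebesgue_on \<Omega>)" for s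
  have gap: "gap s = 1 / 2 * c s + K" if s: "s \<in> assignments \<Omega> v" for s
  proof -
    have 1: "integrable (lebesgue_on \<Omega>) (\<lambda>x. (norm x)\<^sup>2)"
      by (intro integrable_continuous_on_compact \<Omega> continuous_intros)
    have 2: "integrable (lebesgue_on \<Omega>) (\<lambda>x. x \<bullet> Z $ s x)"
      by (intro assignment_integrable(1)[OF s \<Omega>, where f = "\<lambda>i x. x \<bullet> Z $ i"] continuous_intros)
    have 3: "integrable (lebesgue_on \<Omega>) (\<lambda>x. (norm (Z $ s x))\<^sup>2)"
      by (intro assignment_integrable(1)[OF s \<Omega>, where f = "\<lambda>i x. (norm (Z $ i))\<^sup>2"] continuous_intros)
    have "c s = (\<integral>x. (norm x)\<^sup>2 - 2 * (x \<bullet> Z $ s x) + (norm (Z $ s x))\<^sup>2 \<partial>lebesgue_on \<Omega>)"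
      unfolding c_def
      by (intro Bochner_Integration.integral_cong) (auto simp: power2_norm_eq_inner algebra_simps inner_commute)
    also have "\<dots> = (\<integral>x. (norm x)\<^sup>2 \<partial>lebesgue_on \<Omega>) - 2 * (\<integral>x. x \<bullet> Z $ s x \<partial>lebesgue_on \<Omega>)
        + (\<Sum>i\<in>UNIV. v $ i * (norm (Z $ i))\<^sup>2)"
      using 1 2 3 assignment_integral_const[OF s \<Omega>, of "\<lambda>i. (norm (Z $ i))\<^sup>2"] by simp
    finally show ?thesis by (simp add: K_def gap_def field_simps)
  qed
  have c0: "0 \<le> c s" for s unfolding c_def by (intro integral_nonneg_AE) auto
  have bdd_c: "bdd_below (c ` assignments \<Omega> v)" by (rule bdd_belowI2[of _ 0]) (rule c0)
  have bdd: "bdd_below (gap ` assignments \<Omega> v)"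
    by (rule bdd_belowI2[of _ K]) (use c0 in \<open>simp add: gap\<close>)
  then show "bdd_below ((\<lambda>s. (\<integral>x. x \<bullet> Z $ r x \<partial>lebesgue_on \<Omega>) - (\<integral>x. x \<bullet> Z $ s x \<partial>lebesgue_on \<Omega>)) ` assignments \<Omega> v)"
    unfolding gap_def .
  have ne: "assignments \<Omega> v \<noteq> {}" using r by auto
  have "H \<Omega> v B Z = 1 / 2 * (INF s\<in>assignments \<Omega> v. c s) + K"
    by (simp add: H_def W2_squared_eq[OF \<Omega> v] B K_def c_def)
  \<comment> \<open>An infimum commutes with an increasing affine map; both inequalities are checked
    by hand.\<close>
  also have "\<dots> = (INF s\<in>assignments \<Omega> v. gap s)"
  proof (rule antisym)
    show "1 / 2 * (INF s\<in>assignments \<Omega> v. c s) + K \<le> (INF s\<in>assignments \<Omega> v. gap s)"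
      using cINF_lower[OF bdd_c] by (intro cINF_greatest[OF ne]) (simp add: gap)
    have "2 * ((INF s\<in>assignments \<Omega> v. gap s) - K) \<le> (INF s\<in>assignments \<Omega> v. c s)"
      using cINF_lower[OF bdd] by (intro cINF_greatest[OF ne]) (fastforce simp: gap)
    then show "(INF s\<in>assignments \<Omega> v. gap s) \<le> 1 / 2 * (INF s\<in>assignments \<Omega> v. c s) + K" by simp
  qed
  finally show "H \<Omega> v B Z = (INF s\<in>assignments \<Omega> v.
      (\<integral>x. x \<bullet> Z $ r x \<partial>lebesgue_on \<Omega>) - (\<integral>x. x \<bullet> Z $ s x \<partial>lebesgue_on \<Omega>))"
    unfolding gap_def .
qed

theorem theorem4p6:
  fixes \<Omega> :: "(real ^ 'd) set"
    and X B :: "(real ^ 'd) ^ ('n::{finite,linorder})"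
    and w v :: "real ^ ('n::{finite,linorder})"
  assumes "CARD('d) \<ge> 2"
    and "\<Omega> \<noteq> {}" and "convex \<Omega>" and "bounded \<Omega>" and "closure (interior \<Omega>) = \<Omega>"
    and "X \<in> distinct_seeds"
    and "\<And>i. vol (Lag \<Omega> X w i) > 0"
    and "v = (\<chi> i. vol (Lag \<Omega> X w i))"
    and "B = (\<chi> i. centroid (Lag \<Omega> X w i))"
  shows "concave_on UNIV (H \<Omega> v B)
    \<and> (\<exists>Y\<in>distinct_seeds. \<forall>Z. H \<Omega> v B Z \<le> H \<Omega> v B Y)
    \<and> (\<forall>Y\<in>distinct_seeds. (\<forall>Z. H \<Omega> v B Z \<le> H \<Omega> v B Y) \<longrightarrow>
          (\<forall>i. Lcell \<Omega> Y v i = Lcell \<Omega> X v i))"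
proof -
  have "closed \<Omega>" using assms(5) by (metis closed_closure)
  then have \<Omega>: "compact \<Omega>" using assms(4) by (simp add: compact_eq_bounded_closed)
  note X = assms(6)
  have vol: "vol (Lag \<Omega> X w i) = v $ i" for i using assms(8) by simp
  have v: "0 < v $ i" for i using assms(7,8) by simp
  have v': "0 \<le> v $ i" for i using v by (rule less_imp_le)
  define J where "J Z s = (\<integral>x. x \<bullet> Z $ s x \<partial>lebesgue_on \<Omega>)" for Z :: "(real ^ 'd) ^ ('n::{finite,linorder})" and s
  \<comment> \<open>The Laguerre partition of the given data, whose correlation with any Z is the
    linear term of \<open>H\<close>.\<close>
  define r where "r = lag_select \<Omega> X w"
  have r: "r \<in> assignments \<Omega> v" unfolding r_def by (rule lag_select_assignment[OF \<Omega> X vol])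
  have B: "(\<Sum>i\<in>UNIV. v $ i * (Z $ i \<bullet> B $ i)) = J Z r" for Z
    unfolding J_def r_def integral_lag_select[OF \<Omega> X assms(7)] by (simp add: assms(8,9))
  note H_INF = H_eq_INF(1)[OF \<Omega> v' r B[unfolded J_def], folded J_def]
  have H_le: "H \<Omega> v B Z \<le> J Z r - J Z s" if "s \<in> assignments \<Omega> v" for Z s
    unfolding H_INF
    using H_eq_INF(2)[OF \<Omega> v' r B[unfolded J_def], folded J_def] that by (rule cINF_lower)
  have H_ge: "c \<le> H \<Omega> v B Z" if "\<And>s. s \<in> assignments \<Omega> v \<Longrightarrow> c \<le> J Z r - J Z s" for c Z
    unfolding H_INF using r that by (intro cINF_greatest) auto
  have J_linear: "J (a *\<^sub>R Z + b *\<^sub>R Z') s = a * J Z s + b * J Z' s" if s: "s \<in> assignments \<Omega> v" for a b Z Z' s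
  proof -
    have "integrable (lebesgue_on \<Omega>) (\<lambda>x. x \<bullet> Z $ s x)" for Z
      by (intro assignment_integrable(1)[OF s \<Omega>, where f = "\<lambda>i x. x \<bullet> Z $ i"] continuous_intros)
    then show ?thesis by (simp add: J_def inner_add_right)
  qed
  \<comment> \<open>For fixed s the gap \<open>J Z r - J Z s\<close> is linear in Z, and an infimum
    of linear functions is concave.\<close>
  have "concave_on UNIV (H \<Omega> v B)"
    unfolding concave_on_iff
  proof (intro conjI ballI allI impI)
    fix Z Z' :: "(real ^ 'd) ^ ('n::{finite,linorder})" and a b :: real
    assume ab: "0 \<le> a" "0 \<le> b" "a + b = 1"
    show "a * H \<Omega> v B Z + b * H \<Omega> v B Z' \<le> H \<Omega> v B (a *\<^sub>R Z + b *\<^sub>R Z')"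
    proof (rule H_ge)
      fix s assume s: "s \<in> assignments \<Omega> v"
      have "a * H \<Omega> v B Z + b * H \<Omega> v B Z' \<le> a * (J Z r - J Z s) + b * (J Z' r - J Z' s)"
        using ab by (intro add_mono mult_left_mono H_le s)
      then show "a * H \<Omega> v B Z + b * H \<Omega> v B Z' \<le> J (a *\<^sub>R Z + b *\<^sub>R Z') r - J (a *\<^sub>R Z + b *\<^sub>R Z') s"
        by (simp add: J_linear s r algebra_simps)
    qed
  qed simp
  moreover have nonpos: "H \<Omega> v B Z \<le> 0" for Z
    using H_le[OF r, of Z] by simp
  \<comment> \<open>r is a Laguerre partition for the seeds X, so every gap at X is nonnegative.
    With the upper bound 0 this makes X a maximiser.\<close>
  moreover have H_X: "0 \<le> H \<Omega> v B X"
    using Lag_optimal(1)[OF \<Omega> _ r, of _ X w] lag_select_mem[of _ \<Omega> X w]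
    by (intro H_ge) (auto simp: J_def r_def)
  moreover have "Lcell \<Omega> Y v i = Lcell \<Omega> X v i"
    if Y: "Y \<in> distinct_seeds" and max: "\<forall>Z. H \<Omega> v B Z \<le> H \<Omega> v B Y" for Y i
  proof -
    have "(\<Sum>i\<in>UNIV. v $ i) = vol \<Omega>"
      using sum_vol_Lag[OF \<Omega> X, of w] by (simp add: vol)
    then obtain w' where w': "\<And>i. vol (Lag \<Omega> Y w' i) = v $ i"
      using exists_weights[OF \<Omega> Y v] by metis
    have "0 \<le> H \<Omega> v B Y" using max by (intro order_trans[OF H_X]) blast
    \<comment> \<open>Testing the infimum with the Laguerre partition of Y for the same volumes
      shows that r has at least its correlation with Y.\<close>
    then have "J Y (lag_select \<Omega> Y w') \<le> J Y r"
      using H_le[OF lag_select_assignment[OF \<Omega> Y w'], of Y] by linarith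
    then have "Lag \<Omega> X w i = Lag \<Omega> Y w' i"
      using Lag_eq_of_optimal[OF \<Omega> assms(3) X Y v vol w'] by (simp add: J_def r_def)
    then show ?thesis
      by (simp add: Lcell_eq[OF \<Omega> assms(3) X v vol] Lcell_eq[OF \<Omega> assms(3) Y v w'])
  qed
  ultimately show ?thesis using X order_trans[OF nonpos H_X] by blast
qed

end
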